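(* Let $L$ be a finite semidistributive lattice. Then for each $\gamma \in \mathrm{Cov}(L)$ the poset $\mathrm{Cov}(L,\gamma)$ is a semidistributive lattice.
   Context: A lattice is join-semidistributive if $x\vee y = x\vee z$ implies $x \vee (y\wedge z) = x\vee y$; meet-semidistributive if the dual implication holds; semidistributive if both hold. For a poset $P$, $\mathrm{Cov}(P)$ is the set of covers: pairs $\gamma=(\gamma_0,\gamma_1)\in P^2$ with $\gamma_0<\gamma_1$ and no element strictly between them (written $\gamma_0\prec\gamma_1$). For a finite lattice $L$, $\mathrm{Cov}(L)$ is partially ordered by: $\gamma\le\delta$ iff $\gamma_0\le\delta_0$, $\gamma_1\not\le\delta_0$ and $\gamma_1\le\delta_1$. For $\gamma\in\mathrm{Cov}(L)$, $\mathrm{Cov}(L,\gamma)$ denotes the connected component of $\gamma$ in the poset $\mathrm{Cov}(L)$ (connectedness with respect to the comparability relation), with the induced order. *)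

theory Defs
  imports "HOL-Algebra.Lattice"
begin

locale join_semidistributive_lattice = lattice +
  assumes join_semidistributive:
    "\<lbrakk>x \<in> carrier L; y \<in> carrier L; z \<in> carrier L; x \<squnion> y = x \<squnion> z\<rbrakk>
      \<Longrightarrow> x \<squnion> (y \<sqinter> z) = x \<squnion> y"

locale meet_semidistributive_lattice = lattice +
  assumes meet_semidistributive:
    "\<lbrakk>x \<in> carrier L; y \<in> carrier L; z \<in> carrier L; x \<sqinter> y = x \<sqinter> z\<rbrakk>
      \<Longrightarrow> x \<sqinter> (y \<squnion> z) = x \<sqinter> y"

locale semidistributive_lattice =
  join_semidistributive_lattice + meet_semidistributive_lattice

definition covers :: "('a, 'b) gorder_scheme \<Rightarrow> ('a \<times> 'a) set" where
  "covers P = {(a, b). a \<in> carrier P \<and> b \<in> carrier P \<and> a \<sqsubset>\<^bsub>P\<^esub> b \<and>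
     \<not> (\<exists>c \<in> carrier P. a \<sqsubset>\<^bsub>P\<^esub> c \<and> c \<sqsubset>\<^bsub>P\<^esub> b)}"

definition Cov :: "('a, 'b) gorder_scheme \<Rightarrow> ('a \<times> 'a) gorder" where
  "Cov L =
    \<lparr> carrier = covers L,
      eq = (=),
      le = (\<lambda>\<gamma> \<delta>. fst \<gamma> \<sqsubseteq>\<^bsub>L\<^esub> fst \<delta> \<and> \<not> snd \<gamma> \<sqsubseteq>\<^bsub>L\<^esub> fst \<delta> \<and> snd \<gamma> \<sqsubseteq>\<^bsub>L\<^esub> snd \<delta>) \<rparr>"

definition comparability :: "('a, 'b) gorder_scheme \<Rightarrow> 'a rel" where
  "comparability P = {(x, y). x \<in> carrier P \<and> y \<in> carrier P \<and> (x \<sqsubseteq>\<^bsub>P\<^esub> y \<or> y \<sqsubseteq>\<^bsub>P\<^esub> x)}"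

definition connected_component_of_poset ::
    "'a gorder \<Rightarrow> 'a \<Rightarrow> 'a gorder" where
  "connected_component_of_poset P x =
    P\<lparr>carrier := {y \<in> carrier P. (x, y) \<in> (comparability P)\<^sup>*}\<rparr>"

definition Cov_component :: "('a, 'b) gorder_scheme \<Rightarrow> 'a \<times> 'a \<Rightarrow> ('a \<times> 'a) gorder" where
  "Cov_component L \<gamma> = connected_component_of_poset (Cov L) \<gamma>"

end

theory Submission
  imports Defs
begin

text \<open>
  The order on covers is perspectivity: \<open>\<gamma> \<le> \<delta>\<close> forces
  \<open>\<gamma>\<^sub>0 = \<gamma>\<^sub>1 \<sqinter> \<delta>\<^sub>0\<close> and \<open>\<delta>\<^sub>1 = \<gamma>\<^sub>1 \<squnion> \<delta>\<^sub>0\<close>.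
  For a cover \<open>(a, b)\<close>, semidistributivity yields a least \<open>j\<close> with
  \<open>j \<le> b\<close>, \<open>\<not> j \<le> a\<close> and a greatest \<open>m\<close> with \<open>a \<le> m\<close>, \<open>\<not> b \<le> m\<close>;
  both are constant on the connected component of the cover. On that component
  \<open>b = a \<squnion> j\<close> and \<open>a = b \<sqinter> m\<close>, so a cover is determined by either coordinate
  and the order is the order of either coordinate. Joins are computed as
  joins of the upper coordinates and meets as meets of the lower ones.
  If \<open>(a, b) \<squnion> (c, d) = (a, b) \<squnion> (e, f)\<close>, then, since \<open>d = c \<squnion> j\<close>,
  \<open>f = e \<squnion> j\<close> and \<open>j \<le> b\<close>, we get \<open>b \<squnion> c = b \<squnion> e\<close>, hence
  \<open>b \<squnion> (c \<sqinter> e) = b \<squnion> c\<close> in \<open>L\<close>, which is join-semidistributivity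
  in the upper coordinate.
\<close>

section \<open>Extremal elements of finite sets closed under meets or joins\<close>

lemma (in weak_lower_semilattice) finite_meet_closed_least:
  assumes "finite A" "A \<noteq> {}" "A \<subseteq> carrier L"
    and closed: "\<And>x y. \<lbrakk>x \<in> A; y \<in> A\<rbrakk> \<Longrightarrow> x \<sqinter> y \<in> A"
  obtains l where "least L l A"
proof -
  \<comment> \<open>The subsets \<open>B\<close> need not be closed under meets, so the induction
    only asks for a lower bound of \<open>B\<close> that lies in \<open>A\<close>. For
    \<open>B = A\<close> this bound is the least element.\<close>
  have "\<exists>l\<in>A. \<forall>x\<in>B. l \<sqsubseteq> x" if "finite B" "B \<noteq> {}" "B \<subseteq> A" for B
    using that
  proof (induction B rule: finite_ne_induct)
    case (singleton x)
    then show ?case using assms(3) by (intro bexI[of _ x]) auto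
  next
    case (insert x B)
    then obtain l where l: "l \<in> A" "\<forall>y\<in>B. l \<sqsubseteq> y" by blast
    have "x \<in> A" "B \<subseteq> A" using insert.prems by auto
    moreover have "x \<sqinter> l \<sqsubseteq> y" if "y \<in> B" for y
      using that l \<open>x \<in> A\<close> \<open>B \<subseteq> A\<close> assms(3) le_trans[of "x \<sqinter> l" l y] meet_right[of x l]
        meet_closed[of x l] by blast
    ultimately show ?case
      using l closed assms(3) meet_left[of x l] subsetD[OF assms(3)]
      by (intro bexI[of _ "x \<sqinter> l"]) auto
  qed
  from this[of A] show thesis
    using assms that unfolding least_def by blast
qed

lemma (in weak_upper_semilattice) finite_join_closed_greatest:
  assumes "finite A" "A \<noteq> {}" "A \<subseteq> carrier L"
    and closed: "\<And>x y. \<lbrakk>x \<in> A; y \<in> A\<rbrakk> \<Longrightarrow> x \<squnion> y \<in> A"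
  obtains g where "greatest L g A"
proof -
  interpret dual: weak_partial_order "inv_gorder L"
    by (rule dual_weak_order)
  interpret dual: weak_lower_semilattice "inv_gorder L"
    by unfold_locales (simp add: sup_of_two_exists)
  show thesis
    using dual.finite_meet_closed_least[of A] assms that by auto
qed

section \<open>The elements \<open>j\<close> and \<open>m\<close> attached to a single cover\<close>

lemma (in partial_order) covers_iff:
  "(a, b) \<in> covers L \<longleftrightarrow> a \<in> carrier L \<and> b \<in> carrier L \<and> a \<sqsubseteq> b \<and> \<not> b \<sqsubseteq> a \<and>
    (\<forall>c\<in>carrier L. a \<sqsubseteq> c \<longrightarrow> c \<sqsubseteq> b \<longrightarrow> c = a \<or> c = b)"
  unfolding covers_def lless_eq by auto

context lattice
begin

text \<open>\<open>a \<squnion> x\<close> lies between \<open>a\<close> and \<open>b\<close> and is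
  not \<open>a\<close>, so only \<open>b\<close> remains.\<close>

lemma covers_join:
  assumes "(a, b) \<in> covers L" "x \<in> carrier L" "x \<sqsubseteq> b" "\<not> x \<sqsubseteq> a"
  shows "a \<squnion> x = b"
proof -
  have "a \<in> carrier L" "b \<in> carrier L" "a \<sqsubseteq> b" using assms covers_iff by auto
  then show ?thesis
    using assms join_left[of a x] join_right[of a x] join_le[of a b x] covers_iff
    by (metis join_closed)
qed

lemma covers_meet:
  assumes "(a, b) \<in> covers L" "x \<in> carrier L" "a \<sqsubseteq> x" "\<not> b \<sqsubseteq> x"
  shows "b \<sqinter> x = a"
proof -
  have "a \<in> carrier L" "b \<in> carrier L" "a \<sqsubseteq> b" using assms covers_iff by auto
  then show ?thesis
    using assms meet_left[of b x] meet_right[of b x] meet_le[of a b x] covers_iff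
    by (metis meet_closed)
qed

end

text \<open>By \<open>covers_join\<close> all members of the set have the same join \<open>b\<close>
  with \<open>a\<close>. Join-semidistributivity keeps this join when two members are replaced by
  their meet, so the finite set is closed under meets.\<close>

lemma (in join_semidistributive_lattice) covers_least_exists:
  assumes "finite (carrier L)" "(a, b) \<in> covers L"
  obtains j where "least L j {x \<in> carrier L. x \<sqsubseteq> b \<and> \<not> x \<sqsubseteq> a}"
proof (rule finite_meet_closed_least)
  let ?A = "{x \<in> carrier L. x \<sqsubseteq> b \<and> \<not> x \<sqsubseteq> a}"
  have ab: "a \<in> carrier L" "b \<in> carrier L" "\<not> b \<sqsubseteq> a" using assms covers_iff by auto
  show "finite ?A" "?A \<subseteq> carrier L" using assms by auto
  show "?A \<noteq> {}" using ab by auto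
  fix x y assume "x \<in> ?A" "y \<in> ?A"
  then have xy: "x \<in> carrier L" "y \<in> carrier L" "x \<sqsubseteq> b" "a \<squnion> x = b" "a \<squnion> y = b"
    using covers_join[OF assms(2)] by auto
  then have "a \<squnion> (x \<sqinter> y) = b" using join_semidistributive[of a x y] ab by simp
  then have "\<not> x \<sqinter> y \<sqsubseteq> a"
    using ab xy join_le[of a a "x \<sqinter> y"] by auto
  moreover have "x \<sqinter> y \<sqsubseteq> b"
    using le_trans[OF meet_left] xy ab by simp
  ultimately show "x \<sqinter> y \<in> ?A" using xy by simp
qed

text \<open>Dually, all members have meet \<open>a\<close> with \<open>b\<close>, and
  meet-semidistributivity closes the set under joins.\<close>

lemma (in meet_semidistributive_lattice) covers_greatest_exists:
  assumes "finite (carrier L)" "(a, b) \<in> covers L"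
  obtains m where "greatest L m {x \<in> carrier L. a \<sqsubseteq> x \<and> \<not> b \<sqsubseteq> x}"
proof (rule finite_join_closed_greatest)
  let ?A = "{x \<in> carrier L. a \<sqsubseteq> x \<and> \<not> b \<sqsubseteq> x}"
  have ab: "a \<in> carrier L" "b \<in> carrier L" "\<not> b \<sqsubseteq> a" using assms covers_iff by auto
  show "finite ?A" "?A \<subseteq> carrier L" using assms by auto
  show "?A \<noteq> {}" using ab by auto
  fix x y assume "x \<in> ?A" "y \<in> ?A"
  then have xy: "x \<in> carrier L" "y \<in> carrier L" "a \<sqsubseteq> x" "b \<sqinter> x = a" "b \<sqinter> y = a"
    using covers_meet[OF assms(2)] by auto
  then have "b \<sqinter> (x \<squnion> y) = a" using meet_semidistributive[of b x y] ab by simp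
  then have "\<not> b \<sqsubseteq> x \<squnion> y"
    using ab xy meet_le[of b b "x \<squnion> y"] by auto
  moreover have "a \<sqsubseteq> x \<squnion> y"
    using le_trans[OF _ join_left] xy ab by simp
  ultimately show "x \<squnion> y \<in> ?A" using xy by simp
qed

section \<open>Invariance of \<open>j\<close> and \<open>m\<close> under comparability of
  covers\<close>

lemma Cov_simps [simp]:
  "carrier (Cov L) = covers L"
  "eq (Cov L) = (=)"
  "le (Cov L) p q \<longleftrightarrow>
    fst p \<sqsubseteq>\<^bsub>L\<^esub> fst q \<and> \<not> snd p \<sqsubseteq>\<^bsub>L\<^esub> fst q \<and> snd p \<sqsubseteq>\<^bsub>L\<^esub> snd q"
  by (auto simp: Cov_def)

context lattice
begin

text \<open>The set of the lower cover is the part below \<open>b\<close> of the set of the upper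
  cover. As \<open>b\<close> itself belongs to the larger set, the least element of that set falls
  into this part. Existence is assumed for the larger set, since a least element of the part alone
  does not bound the rest.\<close>

lemma Cov_le_least_iff:
  assumes "(a, b) \<in> covers L" "(c, d) \<in> covers L" "le (Cov L) (a, b) (c, d)"
    and "\<exists>j. least L j {x \<in> carrier L. x \<sqsubseteq> d \<and> \<not> x \<sqsubseteq> c}"
  shows "least L j {x \<in> carrier L. x \<sqsubseteq> b \<and> \<not> x \<sqsubseteq> a} \<longleftrightarrow>
    least L j {x \<in> carrier L. x \<sqsubseteq> d \<and> \<not> x \<sqsubseteq> c}" (is "least L j ?A \<longleftrightarrow> least L j ?B")
proof -
  have carr: "a \<in> carrier L" "b \<in> carrier L" "c \<in> carrier L" "d \<in> carrier L"
    using assms covers_iff by auto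
  have le: "a \<sqsubseteq> c" "\<not> b \<sqsubseteq> c" "b \<sqsubseteq> d" using assms(3) by auto
  have meet: "b \<sqinter> c = a" using covers_meet assms(1) carr le by blast
  have b: "b \<in> ?B" using le carr by auto
  \<comment> \<open>For \<open>x\<close> below \<open>b\<close>, lying below \<open>c\<close> and
    lying below \<open>a\<close> are the same, because \<open>b \<sqinter> c = a\<close>.\<close>
  have AB: "x \<in> ?A \<longleftrightarrow> x \<in> ?B \<and> x \<sqsubseteq> b" for x
    using carr le meet meet_le[of x b c] le_trans[of x b d] le_trans[of x a c] by auto
  show ?thesis
  proof
    assume j: "least L j ?A"
    obtain k where k: "least L k ?B" using assms(4) by blast
    have kB: "k \<in> ?B" "k \<sqsubseteq> b" using k b unfolding least_def by auto
    then have kA: "k \<in> ?A" using AB by blast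
    have jA: "j \<in> ?A" using j unfolding least_def by blast
    then have "j \<in> ?B" using AB by blast
    then have "k \<sqsubseteq> j" using k unfolding least_def by blast
    moreover have "j \<sqsubseteq> k" using kA j unfolding least_def by blast
    ultimately have "j = k" using le_antisym[of j k] jA kA by simp
    then show "least L j ?B" using k by simp
  next
    assume j: "least L j ?B"
    then have "j \<in> ?B" "j \<sqsubseteq> b" using b unfolding least_def by auto
    then have "j \<in> ?A" using AB by blast
    moreover have "j \<sqsubseteq> x" if "x \<in> ?A" for x
    proof -
      have "x \<in> ?B" using that AB by blast
      then show ?thesis using j unfolding least_def by blast
    qed
    ultimately show "least L j ?A" unfolding least_def by blast
  qed
qed

text \<open>Here the upper cover has the smaller set, namely the part above \<open>c\<close> of the
  other one, so existence is assumed for the lower cover.\<close>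

lemma Cov_le_greatest_iff:
  assumes "(a, b) \<in> covers L" "(c, d) \<in> covers L" "le (Cov L) (a, b) (c, d)"
    and "\<exists>m. greatest L m {x \<in> carrier L. a \<sqsubseteq> x \<and> \<not> b \<sqsubseteq> x}"
  shows "greatest L m {x \<in> carrier L. a \<sqsubseteq> x \<and> \<not> b \<sqsubseteq> x} \<longleftrightarrow>
    greatest L m {x \<in> carrier L. c \<sqsubseteq> x \<and> \<not> d \<sqsubseteq> x}"
    (is "greatest L m ?A \<longleftrightarrow> greatest L m ?B")
proof -
  have carr: "a \<in> carrier L" "b \<in> carrier L" "c \<in> carrier L" "d \<in> carrier L"
    using assms covers_iff by auto
  have le: "a \<sqsubseteq> c" "\<not> b \<sqsubseteq> c" "b \<sqsubseteq> d" using assms(3) by auto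
  have join: "c \<squnion> b = d" using covers_join assms(2) carr le by blast
  have c: "c \<in> ?A" using le carr by auto
  have AB: "x \<in> ?B \<longleftrightarrow> x \<in> ?A \<and> c \<sqsubseteq> x" for x
    using carr le join join_le[of c x b] le_trans[of a c x] le_trans[of b d x] by auto
  show ?thesis
  proof
    assume m: "greatest L m ?A"
    then have "m \<in> ?A" "c \<sqsubseteq> m" using c unfolding greatest_def by auto
    then have "m \<in> ?B" using AB by blast
    moreover have "x \<sqsubseteq> m" if "x \<in> ?B" for x
    proof -
      have "x \<in> ?A" using that AB by blast
      then show ?thesis using m unfolding greatest_def by blast
    qed
    ultimately show "greatest L m ?B" unfolding greatest_def by blast
  next
    assume m: "greatest L m ?B"
    obtain k where k: "greatest L k ?A" using assms(4) by blast
    have kA: "k \<in> ?A" "c \<sqsubseteq> k" using k c unfolding greatest_def by auto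
    then have kB: "k \<in> ?B" using AB by blast
    have mB: "m \<in> ?B" using m unfolding greatest_def by blast
    then have "m \<in> ?A" using AB by blast
    then have "m \<sqsubseteq> k" using k unfolding greatest_def by blast
    moreover have "k \<sqsubseteq> m" using kB m unfolding greatest_def by blast
    ultimately have "m = k" using le_antisym[of m k] mB kB by simp
    then show "greatest L m ?A" using k by simp
  qed
qed

end

section \<open>Order, joins and meets of covers sharing \<open>j\<close> and
  \<open>m\<close>\<close>

text \<open>Abstracts a connected component to closure under comparability and a common pair
  \<open>j\<close>, \<open>m\<close>. Semidistributivity enters the construction of joins and meets
  only through this pair.\<close>

locale perspective_covers = lattice L for L (structure) +
  fixes K :: "('a \<times> 'a) set" and j m :: 'a
  assumes K_covers: "p \<in> K \<Longrightarrow> p \<in> covers L"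
    and K_closed: "\<lbrakk>p \<in> K; q \<in> covers L; le (Cov L) p q \<or> le (Cov L) q p\<rbrakk> \<Longrightarrow> q \<in> K"
    and least_j: "(a, b) \<in> K \<Longrightarrow> least L j {x \<in> carrier L. x \<sqsubseteq> b \<and> \<not> x \<sqsubseteq> a}"
    and greatest_m: "(a, b) \<in> K \<Longrightarrow> greatest L m {x \<in> carrier L. a \<sqsubseteq> x \<and> \<not> b \<sqsubseteq> x}"
begin

abbreviation CovK :: "('a \<times> 'a) gorder" where
  "CovK \<equiv> (Cov L)\<lparr>carrier := K\<rparr>"

lemma K_D:
  assumes "(a, b) \<in> K"
  shows "a \<in> carrier L" "b \<in> carrier L" "a \<sqsubseteq> b" "j \<in> carrier L" "m \<in> carrier L"
    "j \<sqsubseteq> b" "\<not> j \<sqsubseteq> a" "a \<sqsubseteq> m" "\<not> b \<sqsubseteq> m" "a \<squnion> j = b" "b \<sqinter> m = a"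
proof -
  note c = K_covers[OF assms]
  show "a \<in> carrier L" "b \<in> carrier L" "a \<sqsubseteq> b" using c covers_iff by auto
  show j: "j \<in> carrier L" "j \<sqsubseteq> b" "\<not> j \<sqsubseteq> a"
    using least_j[OF assms] unfolding least_def by auto
  show m: "m \<in> carrier L" "a \<sqsubseteq> m" "\<not> b \<sqsubseteq> m"
    using greatest_m[OF assms] unfolding greatest_def by auto
  show "a \<squnion> j = b" "b \<sqinter> m = a" using covers_join[OF c] covers_meet[OF c] j m by auto
qed

text \<open>By maximality of \<open>m\<close>, such a \<open>z\<close> lies above \<open>b\<close>.
  The conclusion no longer mentions the cover, so it can be combined with another cover of
  \<open>K\<close>.\<close>

lemma j_le_above:
  assumes "(a, b) \<in> K" "z \<in> carrier L" "a \<sqsubseteq> z" "\<not> z \<sqsubseteq> m"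
  shows "j \<sqsubseteq> z"
proof -
  note K = K_D[OF assms(1)]
  have "b \<sqsubseteq> z" using greatest_m[OF assms(1)] assms unfolding greatest_def by blast
  then show ?thesis using le_trans[of j b z] K assms(2) by blast
qed

lemma le_m_below:
  assumes "(a, b) \<in> K" "z \<in> carrier L" "z \<sqsubseteq> b" "\<not> j \<sqsubseteq> z"
  shows "z \<sqsubseteq> m"
proof -
  note K = K_D[OF assms(1)]
  have "z \<sqsubseteq> a" using least_j[OF assms(1)] assms unfolding least_def by blast
  then show ?thesis using le_trans[of z a m] K assms(2) by blast
qed

text \<open>\<open>b\<close> is not below \<open>c\<close> because \<open>j\<close> is below
  \<open>b\<close> but not below \<open>c\<close>. If \<open>a \<sqsubseteq> c\<close>, then
  \<open>a\<close> and \<open>j\<close> are both below \<open>d\<close>, hence so is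
  \<open>b = a \<squnion> j\<close>.\<close>

lemma le_iff_fst:
  assumes "(a, b) \<in> K" "(c, d) \<in> K"
  shows "le (Cov L) (a, b) (c, d) \<longleftrightarrow> a \<sqsubseteq> c"
proof -
  note K = K_D[OF assms(1)] K_D[OF assms(2)]
  have "\<not> b \<sqsubseteq> c" using K le_trans[of j b c] by blast
  moreover have "b \<sqsubseteq> d" if "a \<sqsubseteq> c"
    using K that join_le[of a d j] le_trans[of a c d] by auto
  ultimately show ?thesis by auto
qed

text \<open>If \<open>b \<sqsubseteq> d\<close>, then \<open>a\<close> is below both
  \<open>d\<close> and \<open>m\<close>, hence below \<open>d \<sqinter> m = c\<close>.\<close>

lemma le_iff_snd:
  assumes "(a, b) \<in> K" "(c, d) \<in> K"
  shows "le (Cov L) (a, b) (c, d) \<longleftrightarrow> b \<sqsubseteq> d"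
proof -
  note K = K_D[OF assms(1)] K_D[OF assms(2)]
  have "\<not> b \<sqsubseteq> c" using K le_trans[of j b c] by blast
  moreover have "a \<sqsubseteq> c" if "b \<sqsubseteq> d"
    using K that meet_le[of a d m] le_trans[of a b d] by auto
  ultimately show ?thesis by auto
qed

text \<open>Let \<open>z\<close> lie between \<open>y \<sqinter> m\<close> and
  \<open>y = b \<squnion> d\<close>. If \<open>z\<close> is below \<open>m\<close>, it equals
  \<open>y \<sqinter> m\<close>. Otherwise it is above \<open>j\<close>, hence above
  \<open>a \<squnion> j = b\<close> and \<open>c \<squnion> j = d\<close>, and equals
  \<open>y\<close>.\<close>

lemma join_in_K:
  assumes "(a, b) \<in> K" "(c, d) \<in> K"
  shows "((b \<squnion> d) \<sqinter> m, b \<squnion> d) \<in> K"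
proof -
  note K = K_D[OF assms(1)] K_D[OF assms(2)]
  define y where "y = b \<squnion> d"
  have y: "y \<in> carrier L" "b \<sqsubseteq> y" "d \<sqsubseteq> y"
    using K join_left join_right unfolding y_def by auto
  have x: "y \<sqinter> m \<in> carrier L" "y \<sqinter> m \<sqsubseteq> y" "y \<sqinter> m \<sqsubseteq> m"
    using K y meet_left meet_right by auto
  have ax: "a \<sqsubseteq> y \<sqinter> m" using K y meet_le[of a y m] le_trans[of a b y] by auto
  have cx: "c \<sqsubseteq> y \<sqinter> m" using K y meet_le[of c y m] le_trans[of c d y] by auto
  have bx: "\<not> b \<sqsubseteq> y \<sqinter> m" using K x le_trans[of b "y \<sqinter> m" m] by auto
  have "(y \<sqinter> m, y) \<in> covers L"
    unfolding covers_iff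
  proof (intro conjI ballI impI)
    show "\<not> y \<sqsubseteq> y \<sqinter> m" using bx le_trans[of b y "y \<sqinter> m"] x y K by blast
    fix z assume z: "z \<in> carrier L" "y \<sqinter> m \<sqsubseteq> z" "z \<sqsubseteq> y"
    show "z = y \<sqinter> m \<or> z = y"
    proof (cases "z \<sqsubseteq> m")
      case True
      then show ?thesis using z x y K meet_le[of z y m] by blast
    next
      case False
      have az: "a \<sqsubseteq> z" and cz: "c \<sqsubseteq> z"
        using le_trans[of _ "y \<sqinter> m" z] ax cx x z K by blast+
      have "j \<sqsubseteq> z" using j_le_above[OF assms(1)] z az False by blast
      then have "b \<sqsubseteq> z" "d \<sqsubseteq> z"
        using az cz join_le[of a z j] join_le[of c z j] K z by auto
      then have "y \<sqsubseteq> z" using join_le K z unfolding y_def by blast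
      then show ?thesis using y z by blast
    qed
  qed (use x y in auto)
  \<comment> \<open>Comparability with a member of \<open>K\<close> brings the new cover into
    \<open>K\<close>.\<close>
  moreover have "le (Cov L) (a, b) (y \<sqinter> m, y)" using ax bx y by simp
  ultimately show ?thesis using K_closed[OF assms(1)] unfolding y_def by blast
qed

text \<open>Dually, an intermediate \<open>z\<close> above \<open>j\<close> equals
  \<open>x \<squnion> j\<close>. Otherwise it is below \<open>m\<close>, hence below
  \<open>b \<sqinter> m = a\<close> and \<open>d \<sqinter> m = c\<close>, and equals
  \<open>x\<close>.\<close>

lemma meet_in_K:
  assumes "(a, b) \<in> K" "(c, d) \<in> K"
  shows "(a \<sqinter> c, (a \<sqinter> c) \<squnion> j) \<in> K"
proof -
  note K = K_D[OF assms(1)] K_D[OF assms(2)]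
  define x where "x = a \<sqinter> c"
  have x: "x \<in> carrier L" "x \<sqsubseteq> a" "x \<sqsubseteq> c"
    using K meet_left meet_right unfolding x_def by auto
  have y: "x \<squnion> j \<in> carrier L" "x \<sqsubseteq> x \<squnion> j" "j \<sqsubseteq> x \<squnion> j"
    using K x join_left join_right by auto
  have yb: "x \<squnion> j \<sqsubseteq> b" using K x join_le[of x b j] le_trans[of x a b] by auto
  have yd: "x \<squnion> j \<sqsubseteq> d" using K x join_le[of x d j] le_trans[of x c d] by auto
  have ya: "\<not> x \<squnion> j \<sqsubseteq> a" using K y le_trans[of j "x \<squnion> j" a] by auto
  have "(x, x \<squnion> j) \<in> covers L"
    unfolding covers_iff
  proof (intro conjI ballI impI)
    show "\<not> x \<squnion> j \<sqsubseteq> x" using ya le_trans[of "x \<squnion> j" x a] x y K by blast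
    fix z assume z: "z \<in> carrier L" "x \<sqsubseteq> z" "z \<sqsubseteq> x \<squnion> j"
    show "z = x \<or> z = x \<squnion> j"
    proof (cases "j \<sqsubseteq> z")
      case True
      then show ?thesis using z x y K join_le[of x z j] by blast
    next
      case False
      have zb: "z \<sqsubseteq> b" and zd: "z \<sqsubseteq> d"
        using le_trans[of z "x \<squnion> j"] yb yd y z K by blast+
      have "z \<sqsubseteq> m" using le_m_below[OF assms(1)] z zb False by blast
      then have "z \<sqsubseteq> a" "z \<sqsubseteq> c"
        using zb zd meet_le[of z b m] meet_le[of z d m] K z by auto
      then have "z \<sqsubseteq> x" using meet_le K z unfolding x_def by blast
      then show ?thesis using x z by blast
    qed
  qed (use x y in auto)
  moreover have "le (Cov L) (x, x \<squnion> j) (a, b)" using ya yb x by simp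
  ultimately show ?thesis using K_closed[OF assms(1)] unfolding x_def by blast
qed

sublocale CovK: partial_order CovK
proof unfold_locales
  fix p q r
  assume "le CovK p q" "le CovK q r" "p \<in> carrier CovK" "q \<in> carrier CovK" "r \<in> carrier CovK"
  moreover obtain a b c d e f where "p = (a, b)" "q = (c, d)" "r = (e, f)"
    by (metis surj_pair)
  ultimately show "le CovK p r"
    using le_iff_fst[of a b c d] le_iff_fst[of c d e f] le_iff_fst[of a b e f]
      K_D(1)[of a b] K_D(1)[of c d] K_D(1)[of e f] le_trans[of a c e] by simp
next
  fix p q
  assume *: "le CovK p q" "le CovK q p" "p \<in> carrier CovK" "q \<in> carrier CovK"
  then show "eq CovK p q"
    using K_D(1,2)[of "fst p" "snd p"] K_D(1,2)[of "fst q" "snd q"] by (auto intro: prod_eqI)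
next
  fix p assume "p \<in> carrier CovK"
  then show "le CovK p p"
    using le_iff_fst[of "fst p" "snd p" "fst p" "snd p"] K_D(1)[of "fst p" "snd p"] by simp
qed auto

text \<open>Bounds are compared in the upper coordinate, where the candidate is the join in
  \<open>L\<close>; \<open>meet_greatest\<close> compares lower coordinates instead.\<close>

lemma join_least:
  assumes "(a, b) \<in> K" "(c, d) \<in> K"
  shows "least CovK ((b \<squnion> d) \<sqinter> m, b \<squnion> d) (Upper CovK {(a, b), (c, d)})"
proof (rule least_UpperI)
  note K = K_D[OF assms(1)] K_D[OF assms(2)]
  note J = join_in_K[OF assms]
  show "le CovK p ((b \<squnion> d) \<sqinter> m, b \<squnion> d)" if "p \<in> {(a, b), (c, d)}" for p
    using that le_iff_snd[OF assms(1) J] le_iff_snd[OF assms(2) J] K join_left join_right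
    by auto
  show "le CovK ((b \<squnion> d) \<sqinter> m, b \<squnion> d) q" if "q \<in> Upper CovK {(a, b), (c, d)}" for q
  proof -
    obtain e f where q: "q = (e, f)" by (metis surj_pair)
    have "(e, f) \<in> K" "le (Cov L) (a, b) (e, f)" "le (Cov L) (c, d) (e, f)"
      using that assms unfolding q Upper_def by auto
    then show ?thesis
      using q le_iff_snd[OF J, of e f] K K_D(2)[of e f] join_le[of b f d] by auto
  qed
qed (use assms join_in_K in auto)

lemma meet_greatest:
  assumes "(a, b) \<in> K" "(c, d) \<in> K"
  shows "greatest CovK (a \<sqinter> c, (a \<sqinter> c) \<squnion> j) (Lower CovK {(a, b), (c, d)})"
proof (rule greatest_LowerI)
  note K = K_D[OF assms(1)] K_D[OF assms(2)]
  note M = meet_in_K[OF assms]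
  show "le CovK (a \<sqinter> c, (a \<sqinter> c) \<squnion> j) p" if "p \<in> {(a, b), (c, d)}" for p
    using that le_iff_fst[OF M assms(1)] le_iff_fst[OF M assms(2)] K meet_left meet_right
    by auto
  show "le CovK q (a \<sqinter> c, (a \<sqinter> c) \<squnion> j)" if "q \<in> Lower CovK {(a, b), (c, d)}" for q
  proof -
    obtain e f where q: "q = (e, f)" by (metis surj_pair)
    have "(e, f) \<in> K" "le (Cov L) (e, f) (a, b)" "le (Cov L) (e, f) (c, d)"
      using that assms unfolding q Lower_def by auto
    then show ?thesis
      using q le_iff_fst[OF _ M, of e f] K K_D(1)[of e f] meet_le[of e a c] by auto
  qed
qed (use assms meet_in_K in auto)

sublocale CovK: lattice CovK
proof unfold_locales
  fix p q assume "p \<in> carrier CovK" "q \<in> carrier CovK"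
  then have "(fst p, snd p) \<in> K" "(fst q, snd q) \<in> K" by auto
  from join_least[OF this] meet_greatest[OF this]
  show "\<exists>s. least CovK s (Upper CovK {p, q})" "\<exists>s. greatest CovK s (Lower CovK {p, q})"
    by auto
qed

lemma CovK_join:
  assumes "(a, b) \<in> K" "(c, d) \<in> K"
  shows "(a, b) \<squnion>\<^bsub>CovK\<^esub> (c, d) = ((b \<squnion> d) \<sqinter> m, b \<squnion> d)"
  using CovK.joinI[of "(a, b)" "(c, d)" "\<lambda>s. s = ((b \<squnion> d) \<sqinter> m, b \<squnion> d)"]
    CovK.least_unique[OF _ join_least[OF assms]] assms by simp

lemma CovK_meet:
  assumes "(a, b) \<in> K" "(c, d) \<in> K"
  shows "(a, b) \<sqinter>\<^bsub>CovK\<^esub> (c, d) = (a \<sqinter> c, (a \<sqinter> c) \<squnion> j)"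
  using CovK.meetI[of "(a, b)" "(c, d)" "\<lambda>s. s = (a \<sqinter> c, (a \<sqinter> c) \<squnion> j)"]
    CovK.greatest_unique[OF _ meet_greatest[OF assms]] assms by simp

section \<open>Transfer of semidistributivity from \<open>L\<close> to \<open>CovK\<close>\<close>

lemma join_absorb_j:
  assumes "(a, b) \<in> K" "x \<in> carrier L"
  shows "b \<squnion> (x \<squnion> j) = b \<squnion> x"
proof -
  note K = K_D[OF assms(1)]
  have bx: "b \<squnion> x \<in> carrier L" "b \<sqsubseteq> b \<squnion> x" "x \<sqsubseteq> b \<squnion> x" "x \<squnion> j \<in> carrier L"
      "x \<sqsubseteq> x \<squnion> j"
    using K assms(2) join_left join_right by auto
  have "x \<squnion> j \<sqsubseteq> b \<squnion> x"
    using K assms(2) bx join_le[of x "b \<squnion> x" j] le_trans[of j b "b \<squnion> x"] by auto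
  then have "b \<squnion> (x \<squnion> j) \<sqsubseteq> b \<squnion> x" using join_le K bx by simp
  moreover have "x \<sqsubseteq> b \<squnion> (x \<squnion> j)"
    using le_trans[of x "x \<squnion> j" "b \<squnion> (x \<squnion> j)"] join_right[of b "x \<squnion> j"] K bx assms(2) by simp
  then have "b \<squnion> x \<sqsubseteq> b \<squnion> (x \<squnion> j)"
    using join_le[of b "b \<squnion> (x \<squnion> j)" x] join_left[of b "x \<squnion> j"] K bx assms(2) by simp
  ultimately show ?thesis using bx K by (simp add: le_antisym)
qed

lemma meet_absorb_m:
  assumes "(a, b) \<in> K" "x \<in> carrier L"
  shows "a \<sqinter> (x \<sqinter> m) = a \<sqinter> x"
proof -
  note K = K_D[OF assms(1)]
  have ax: "a \<sqinter> x \<in> carrier L" "a \<sqinter> x \<sqsubseteq> a" "a \<sqinter> x \<sqsubseteq> x" "x \<sqinter> m \<in> carrier L"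
      "x \<sqinter> m \<sqsubseteq> x"
    using K assms(2) meet_left meet_right by auto
  have "a \<sqinter> x \<sqsubseteq> x \<sqinter> m"
    using K assms(2) ax meet_le[of "a \<sqinter> x" x m] le_trans[of "a \<sqinter> x" a m] by auto
  then have "a \<sqinter> x \<sqsubseteq> a \<sqinter> (x \<sqinter> m)" using meet_le K ax by simp
  moreover have "a \<sqinter> (x \<sqinter> m) \<sqsubseteq> x"
    using le_trans[of "a \<sqinter> (x \<sqinter> m)" "x \<sqinter> m" x] meet_right[of a "x \<sqinter> m"] K ax assms(2) by simp
  then have "a \<sqinter> (x \<sqinter> m) \<sqsubseteq> a \<sqinter> x"
    using meet_le[of "a \<sqinter> (x \<sqinter> m)" a x] meet_left[of a "x \<sqinter> m"] K ax assms(2) by simp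
  ultimately show ?thesis using ax K by (simp add: le_antisym)
qed

lemma CovK_join_semidistributive:
  assumes "join_semidistributive_lattice L"
  shows "join_semidistributive_lattice CovK"
proof unfold_locales
  interpret join_semidistributive_lattice L by fact
  fix p q r
  assume pqr: "p \<in> carrier CovK" "q \<in> carrier CovK" "r \<in> carrier CovK"
    and eq: "p \<squnion>\<^bsub>CovK\<^esub> q = p \<squnion>\<^bsub>CovK\<^esub> r"
  obtain a b c d e f where [simp]: "p = (a, b)" "q = (c, d)" "r = (e, f)"
    by (metis surj_pair)
  have in_K: "(a, b) \<in> K" "(c, d) \<in> K" "(e, f) \<in> K" using pqr by auto
  note K = in_K[THEN K_D(1)] in_K[THEN K_D(2)]
  \<comment> \<open>Since \<open>d = c \<squnion> j\<close>, \<open>f = e \<squnion> j\<close> and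
    \<open>j \<sqsubseteq> b\<close>, joining with \<open>b\<close> does not distinguish upper from
    lower coordinates.\<close>
  have absorb: "b \<squnion> d = b \<squnion> c" "b \<squnion> f = b \<squnion> e"
    using join_absorb_j[OF in_K(1)] K K_D(10)[OF in_K(2)] K_D(10)[OF in_K(3)] by metis+
  have "b \<squnion> c = b \<squnion> e"
    using eq absorb by (simp add: CovK_join in_K)
  \<comment> \<open>\<open>(c \<sqinter> e) \<squnion> j\<close> is the upper coordinate of the meet
    in \<open>CovK\<close>. Equal upper coordinates suffice, as the lower one of a join arises from
    it by meeting with \<open>m\<close>.\<close>
  then have "b \<squnion> ((c \<sqinter> e) \<squnion> j) = b \<squnion> d"
    using join_semidistributive[of b c e] join_absorb_j[OF in_K(1)] absorb K by simp
  then show "p \<squnion>\<^bsub>CovK\<^esub> (q \<sqinter>\<^bsub>CovK\<^esub> r) = p \<squnion>\<^bsub>CovK\<^esub> q"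
    by (simp add: CovK_join CovK_meet in_K meet_in_K[OF in_K(2,3)])
qed

lemma CovK_meet_semidistributive:
  assumes "meet_semidistributive_lattice L"
  shows "meet_semidistributive_lattice CovK"
proof unfold_locales
  interpret meet_semidistributive_lattice L by fact
  fix p q r
  assume pqr: "p \<in> carrier CovK" "q \<in> carrier CovK" "r \<in> carrier CovK"
    and eq: "p \<sqinter>\<^bsub>CovK\<^esub> q = p \<sqinter>\<^bsub>CovK\<^esub> r"
  obtain a b c d e f where [simp]: "p = (a, b)" "q = (c, d)" "r = (e, f)"
    by (metis surj_pair)
  have in_K: "(a, b) \<in> K" "(c, d) \<in> K" "(e, f) \<in> K" using pqr by auto
  note K = in_K[THEN K_D(1)] in_K[THEN K_D(2)]
  \<comment> \<open>Dually, \<open>c = d \<sqinter> m\<close>, \<open>e = f \<sqinter> m\<close> and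
    \<open>a \<sqsubseteq> m\<close>. Passing to \<open>d\<close> and \<open>f\<close> matches the
    formula for joins, which starts from upper coordinates.\<close>
  have absorb: "a \<sqinter> c = a \<sqinter> d" "a \<sqinter> e = a \<sqinter> f"
    using meet_absorb_m[OF in_K(1)] K K_D(11)[OF in_K(2)] K_D(11)[OF in_K(3)] by metis+
  have "a \<sqinter> d = a \<sqinter> f"
    using eq absorb by (simp add: CovK_meet in_K)
  then have "a \<sqinter> ((d \<squnion> f) \<sqinter> m) = a \<sqinter> c"
    using meet_semidistributive[of a d f] meet_absorb_m[OF in_K(1)] absorb K by simp
  then show "p \<sqinter>\<^bsub>CovK\<^esub> (q \<squnion>\<^bsub>CovK\<^esub> r) = p \<sqinter>\<^bsub>CovK\<^esub> q"
    by (simp add: CovK_join CovK_meet in_K join_in_K[OF in_K(2,3)])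
qed

end

section \<open>Connected components of the poset of covers\<close>

lemma (in semidistributive_lattice) perspective_covers_component:
  assumes fin: "finite (carrier L)" and \<gamma>: "\<gamma> \<in> covers L"
  obtains j m where
    "perspective_covers L {p \<in> covers L. (\<gamma>, p) \<in> (comparability (Cov L))\<^sup>*} j m"
proof -
  let ?J = "\<lambda>j p. least L j {x \<in> carrier L. x \<sqsubseteq> snd p \<and> \<not> x \<sqsubseteq> fst p}"
  let ?M = "\<lambda>m p. greatest L m {x \<in> carrier L. fst p \<sqsubseteq> x \<and> \<not> snd p \<sqsubseteq> x}"
  have exJ: "\<exists>j. ?J j p" if "p \<in> covers L" for p
    using covers_least_exists[OF fin, of "fst p" "snd p"] that by auto
  have exM: "\<exists>m. ?M m p" if "p \<in> covers L" for p
    using covers_greatest_exists[OF fin, of "fst p" "snd p"] that by auto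
  \<comment> \<open>The pair is chosen for \<open>\<gamma>\<close> alone and then carried along
    paths of comparable covers.\<close>
  obtain j m where jm: "?J j \<gamma>" "?M m \<gamma>" using exJ exM \<gamma> by blast
  have comparable: "(?J j p \<longleftrightarrow> ?J j q) \<and> (?M m p \<longleftrightarrow> ?M m q)"
    if "(p, q) \<in> comparability (Cov L)" for p q
    using that exJ[of p] exJ[of q] exM[of p] exM[of q]
      Cov_le_least_iff[of "fst p" "snd p" "fst q" "snd q" j]
      Cov_le_least_iff[of "fst q" "snd q" "fst p" "snd p" j]
      Cov_le_greatest_iff[of "fst p" "snd p" "fst q" "snd q" m]
      Cov_le_greatest_iff[of "fst q" "snd q" "fst p" "snd p" m]
    unfolding comparability_def by auto
  have inv: "?J j p \<and> ?M m p" if "(\<gamma>, p) \<in> (comparability (Cov L))\<^sup>*" for p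
    using that
  proof (induction rule: rtrancl_induct)
    case base
    show ?case using jm by simp
  next
    case (step p q)
    then show ?case using comparable by blast
  qed
  have "perspective_covers L {p \<in> covers L. (\<gamma>, p) \<in> (comparability (Cov L))\<^sup>*} j m"
  proof unfold_locales
    fix p q
    assume p: "p \<in> {p \<in> covers L. (\<gamma>, p) \<in> (comparability (Cov L))\<^sup>*}"
      and q: "q \<in> covers L" "le (Cov L) p q \<or> le (Cov L) q p"
    \<comment> \<open>One more comparability extends a path from \<open>\<gamma>\<close> to
      \<open>p\<close> into a path to \<open>q\<close>.\<close>
    then have "(p, q) \<in> comparability (Cov L)" unfolding comparability_def by auto
    then show "q \<in> {p \<in> covers L. (\<gamma>, p) \<in> (comparability (Cov L))\<^sup>*}"
      using p q by (auto intro: rtrancl_into_rtrancl)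
  qed (use inv in fastforce)+
  then show thesis by (rule that)
qed

theorem theorem6p5:
  fixes L :: "'a gorder" and \<gamma> :: "'a \<times> 'a"
  assumes "semidistributive_lattice L"
    and "finite (carrier L)"
    and "\<gamma> \<in> carrier (Cov L)"
  shows "semidistributive_lattice (Cov_component L \<gamma>)"
proof -
  interpret semidistributive_lattice L by fact
  let ?K = "{p \<in> covers L. (\<gamma>, p) \<in> (comparability (Cov L))\<^sup>*}"
  obtain j m where "perspective_covers L ?K j m"
    using perspective_covers_component[of \<gamma>] assms(2,3) unfolding Cov_simps by blast
  then interpret perspective_covers L ?K j m .
  have "Cov_component L \<gamma> = CovK"
    by (simp add: Cov_component_def connected_component_of_poset_def)
  then show ?thesis
    using CovK_join_semidistributive[OF join_semidistributive_lattice_axioms]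
      CovK_meet_semidistributive[OF meet_semidistributive_lattice_axioms]
    by (simp add: semidistributive_lattice_def)
qed

end
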